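(* Let $h>0$, let $K\ge1$ be an integer, and suppose that: (i) the control set $U\subset\mathbb{R}^q$ is nonempty and compact; (ii) $F_h(x,u)=A_hx+B_hu+b_h$ for $x\in\mathbb{R}^n$, $u\in U$ (affine one-step dynamics); (iii) the terminal reward $\phi:\mathbb{R}^n\to\mathbb{R}$ is continuous and $c_K$-semiconvex, for some $c_K\ge 0$; (iv) there exists $\gamma_h\ge0$ such that, for every $u\in U$, the map $x\mapsto h\,\ell(x,u)$ is continuous and $\gamma_h$-semiconvex on $\mathbb{R}^n$. Let $X\subset\mathbb{R}^n$ be compact and convex, with $F_h(X\times U)\subset X$; assume that $F_h$ and $\ell$ are continuous, and Lipschitz continuous in the state variable $x\in X$ (uniformly in $u\in U$). Let $v_k^h$ be the discrete-time value functions and $T_h$ the discrete Bellman operator, and let $(\widehat v_k^{h,m})_{0\le k\le K,\,m\ge0}$ and the trajectories $x^{(m)}=(x_k^{(m)})_{k=0,\dots,K}$, $m\ge0$, be generated by the trajectory-based iterative algorithm described in the context, with initial trajectory $x^{(0)}$ in $X$ and initial functions $\widehat v_k^{h,0}$ that are Lipschitz continuous on $X$ and satisfy $\widehat v_k^{h,0}\le T_h[\widehat v_{k+1}^{h,0}]$ on $X$ for $k=0,\dots,K-1$. Then, for every $k=0,\dots,K$, the sequence $(\widehat v_k^{h,m})_{m\ge0}$ converges uniformly on $X$ to a Lipschitz continuous function $v_k^{h,*}$ satisfying $$\widehat v_k^{h,m}\le v_k^{h,*}\le v_k^h\quad\text{on }X\ \text{ for all } m\ge 0,$$ and $$v_k^{h,*}\le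 T_h[v_{k+1}^{h,*}]\quad\text{on }X,\qquad k=0,\dots,K-1 .$$ Moreover, for every convergent subsequence $x^{(m_j)}\to x^*=(x_k^* )_{k=0,\dots,K}\in X^{K+1}$, there exist a further subsequence and (as limits of the corresponding forward controls $u_k^{(m)}$ along it) controls $u_k^*\in U$, $k=0,\dots,K-1$, such that, for all $k=0,\dots,K-1$, $x_{k+1}^*=F_h(x_k^*,u_k^* )$, $$u_k^*\in\operatorname{arg\,max}_{u\in U}\bigl\{h\,\ell(x_k^*,u)+v_{k+1}^{h,*}(F_h(x_k^*,u))\bigr\},$$ and $$v_k^{h,*}(x_k^* )=h\,\ell(x_k^*,u_k^* )+v_{k+1}^{h,*}(x_{k+1}^* ).$$
   Context: Semiconvexity: for $c\ge0$, $g:\mathbb{R}^n\to\mathbb{R}$ is $c$-semiconvex if $g+\frac c2\|\cdot\|^2$ is convex (Euclidean norm). Value functions: $\ell:\mathbb{R}^n\times U\to\mathbb{R}$ is the running reward. The discrete Bellman operator is $(T_h\psi)(x)=\sup_{u\in U}\{h\,\ell(x,u)+\psi(F_h(x,u))\}$, for functions $\psi$ on $\mathbb{R}^n$, or, since $F_h(X\times U)\subset X$, for functions $\psi$ on $X$ with $x\in X$. The value functions are $v_K^h=\phi$ and $v_k^h=T_h[v_{k+1}^h]$ on $\mathbb{R}^n$ for $k=K-1,\dots,0$. Set $c_k:=\gamma_h+\|A_h\|^2c_{k+1}$ for $k=K-1,\dots,0$, where $\|A_h\|$ is the Euclidean operator norm. Algorithm. At each outer iteration $m\ge0$ and time $k$,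 the approximation is a finite maximum $$\widehat v_k^{h,m}(x)=\max_{1\le j\le r_k^{(m)}}w_{k,j}^{h,m}(x),\qquad w_{k,j}^{h,m}(x)=\beta+p\cdot(x-a)-\tfrac{c_k}{2}\|x-a\|^2,$$ with $\beta\in\mathbb{R}$, $p,a\in\mathbb{R}^n$ depending on $k,j,m$. Initialization: an initial point $x_0$, a trajectory $x^{(0)}=(x_0^{(0)},\dots,x_K^{(0)})$ with $x_0^{(0)}=x_0$ that is admissible (i.e. $x_{k+1}^{(0)}=F_h(x_k^{(0)},u_k)$ for some $u_k\in U$), and functions $\widehat v_k^{h,0}$, each a finite maximum of functions of the form $x\mapsto\beta+p\cdot(x-a)-\frac{c_k}{2}\|x-a\|^2$ with $\beta\in\mathbb{R}$, $p,a\in\mathbb{R}^n$, with $\widehat v_k^{h,0}\le v_k^h$ on $\mathbb{R}^n$ for all $k$ and $\widehat v_K^{h,0}=\phi$ (so $\phi$ is assumed to be a finite maximum of functions of the form $x\mapsto\beta+p\cdot(x-a)-\frac{c_K}{2}\|x-a\|^2$). One keeps $\widehat v_K^{h,m}=\phi$ for all $m$. Outer iteration $m\ge1$, backward step, for $k=K-1,\dots,0$: choose $$u_k\in\operatorname{arg\,max}_{u\in U}\{h\,\ell(x_k^{(m-1)},u)+\widehat v_{k+1}^{h,m-1}(F_h(x_k^{(m-1)},u))\};$$ choose an index $j$ of a basis function active at the successor state, i.e. $w_{k+1,j}^{h,m-1}(y)=\widehat v_{k+1}^{h,m-1}(y)$ with $y=F_h(x_k^{(m-1)},u_k)$; let $$G_k^{(m)}(x)=h\,\ell(x,u_k)+w_{k+1,j}^{h,m-1}(F_h(x,u_k));$$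 choose $p\in\mathbb{R}^n$ such that $w(x)=G_k^{(m)}(x_k^{(m-1)})+p\cdot(x-x_k^{(m-1)})-\frac{c_k}{2}\|x-x_k^{(m-1)}\|^2$ satisfies $w\le G_k^{(m)}$ on $\mathbb{R}^n$ (equality holds at $x_k^{(m-1)}$). Put $\widehat v_k^{h,m}=\max(\widehat v_k^{h,m-1},w)$, adding $w$ to the list of basis functions if it is not already in it. Forward step: $x_0^{(m)}=x_0$ and, for $k=0,\dots,K-1$, choose $u_k^{(m)}\in\operatorname{arg\,max}_{u\in U}\{h\,\ell(x_k^{(m)},u)+\widehat v_{k+1}^{h,m}(F_h(x_k^{(m)},u))\}$ and set $x_{k+1}^{(m)}=F_h(x_k^{(m)},u_k^{(m)})$. *)

theory Defs
  imports "HOL-Analysis.Analysis"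
begin

definition semiconvex :: "real \<Rightarrow> ('a::real_normed_vector \<Rightarrow> real) \<Rightarrow> bool" where
  "semiconvex c g \<longleftrightarrow> convex_on UNIV (\<lambda>x. g x + c / 2 * (norm x)\<^sup>2)"

text \<open>The supremum is a supremum of reals, hence only meaningful where it is taken over a
  nonempty set that is bounded above; this holds for continuous data and nonempty compact \<open>U\<close>.
  At a point \<open>x\<close> only the values of \<open>\<psi>\<close> at the successors \<open>F x u\<close>, \<open>u \<in> U\<close>, matter, so the same
  operator acts on functions on an invariant set.\<close>

definition bellman ::
  "real \<Rightarrow> ('a \<Rightarrow> 'b \<Rightarrow> real) \<Rightarrow> ('a \<Rightarrow> 'b \<Rightarrow> 'a) \<Rightarrow> 'b set \<Rightarrow> ('a \<Rightarrow> real) \<Rightarrow> 'a \<Rightarrow> real" where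
  "bellman h ell F U \<psi> x = (SUP u\<in>U. h * ell x u + \<psi> (F x u))"

definition greedy ::
  "real \<Rightarrow> ('a \<Rightarrow> 'b \<Rightarrow> real) \<Rightarrow> ('a \<Rightarrow> 'b \<Rightarrow> 'a) \<Rightarrow> 'b set \<Rightarrow> ('a \<Rightarrow> real) \<Rightarrow> 'a \<Rightarrow> 'b \<Rightarrow> bool" where
  "greedy h ell F U \<psi> x u \<longleftrightarrow>
     is_arg_max (\<lambda>u'. h * ell x u' + \<psi> (F x u')) (\<lambda>u'. u' \<in> U) u"

definition quad :: "real \<Rightarrow> real \<Rightarrow> 'a::real_inner \<Rightarrow> 'a \<Rightarrow> 'a \<Rightarrow> real" where
  "quad c \<beta> p a = (\<lambda>x. \<beta> + p \<bullet> (x - a) - c / 2 * (norm (x - a))\<^sup>2)"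

text \<open>The list of basis functions is represented by the finite set of its members, so that
  appending a function unless it is already listed is \<open>insert\<close>, and choosing an index is choosing
  an element.\<close>

definition basis_family :: "real \<Rightarrow> ('a::real_inner \<Rightarrow> real) set \<Rightarrow> bool" where
  "basis_family c W \<longleftrightarrow> finite W \<and> W \<noteq> {} \<and> (\<forall>w\<in>W. \<exists>\<beta> p a. w = quad c \<beta> p a)"

definition fmax :: "('a \<Rightarrow> real) set \<Rightarrow> 'a \<Rightarrow> real" where
  "fmax W x = Max ((\<lambda>w. w x) ` W)"

text \<open>Backward step at one time \<open>k\<close>, with \<open>c = c\<^sub>k\<close>: \<open>x\<close> is the previous trajectory point at
  time \<open>k\<close>, \<open>Wnext\<close> and \<open>W\<close> are the previous families at times \<open>k + 1\<close> and \<open>k\<close>, and \<open>W'\<close> is the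
  updated family at time \<open>k\<close>. The choices of control, active basis function and slope are
  existentially quantified: any admissible choice is allowed.\<close>

definition backward_step ::
  "real \<Rightarrow> ('a::real_inner \<Rightarrow> 'b \<Rightarrow> real) \<Rightarrow> ('a \<Rightarrow> 'b \<Rightarrow> 'a) \<Rightarrow> 'b set \<Rightarrow> real \<Rightarrow> 'a \<Rightarrow>
   ('a \<Rightarrow> real) set \<Rightarrow> ('a \<Rightarrow> real) set \<Rightarrow> ('a \<Rightarrow> real) set \<Rightarrow> bool" where
  "backward_step h ell F U c x Wnext W W' \<longleftrightarrow>
     (\<exists>u w p G. greedy h ell F U (fmax Wnext) x u
        \<and> w \<in> Wnext \<and> w (F x u) = fmax Wnext (F x u)
        \<and> G = (\<lambda>z. h * ell z u + w (F z u))
        \<and> (\<forall>z. quad c (G x) p x z \<le> G z)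
        \<and> W' = insert (quad c (G x) p x) W)"

text \<open>\<open>W m k\<close>, \<open>xt m k\<close> and \<open>uf m k\<close> are the basis family, the trajectory point and the forward
  control at outer iteration \<open>m\<close> and time \<open>k\<close>. The values \<open>uf 0 k\<close> are unconstrained.
  At the terminal time only the maximum \<open>\<phi>\<close> is required to be kept, not the family
  representing it.\<close>

definition trajectory_algorithm ::
  "real \<Rightarrow> ('a::real_inner \<Rightarrow> 'b \<Rightarrow> real) \<Rightarrow> ('a \<Rightarrow> 'b \<Rightarrow> 'a) \<Rightarrow> 'b set \<Rightarrow> nat \<Rightarrow> (nat \<Rightarrow> real) \<Rightarrow>
   ('a \<Rightarrow> real) \<Rightarrow> (nat \<Rightarrow> 'a \<Rightarrow> real) \<Rightarrow> 'a \<Rightarrow>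
   (nat \<Rightarrow> nat \<Rightarrow> ('a \<Rightarrow> real) set) \<Rightarrow> (nat \<Rightarrow> nat \<Rightarrow> 'a) \<Rightarrow> (nat \<Rightarrow> nat \<Rightarrow> 'b) \<Rightarrow> bool" where
  "trajectory_algorithm h ell F U K c \<phi> v x0 W xt uf \<longleftrightarrow>
     (\<forall>m. \<forall>k\<le>K. basis_family (c k) (W m k))
   \<and> (\<forall>m. fmax (W m K) = \<phi>)
   \<and> (\<forall>k\<le>K. \<forall>x. fmax (W 0 k) x \<le> v k x)
   \<and> (\<forall>m. xt m 0 = x0)
   \<and> (\<forall>k<K. \<exists>u\<in>U. xt 0 (Suc k) = F (xt 0 k) u)
   \<and> (\<forall>m. \<forall>k<K. backward_step h ell F U (c k) (xt m k) (W m (Suc k)) (W m k) (W (Suc m) k))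
   \<and> (\<forall>m\<ge>1. \<forall>k<K. greedy h ell F U (fmax (W m (Suc k))) (xt m k) (uf m k)
                   \<and> xt m (Suc k) = F (xt m k) (uf m k))"

end

theory Submission
  imports Defs
begin

text \<open>The approximations increase in \<open>m\<close> and stay below the value functions. Each new cut is below the
  value function on a unit neighbourhood of \<open>X\<close>, which bounds its slope; so the approximations are
  Lipschitz on \<open>X\<close> uniformly in \<open>m\<close>, the monotone limit is uniform, and one may pass to the limit along
  moving points. At each trajectory point the cut of the next backward step attains the maximal
  Bellman value, which gives the equality along limit trajectories.\<close>

section \<open>Sequences of functions with a common Lipschitz constant\<close>

lemma lipschitz_on_max:
  fixes f g :: "'a::metric_space \<Rightarrow> real"
  assumes "L-lipschitz_on X f" and "L-lipschitz_on X g"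
  shows "L-lipschitz_on X (\<lambda>x. max (f x) (g x))"
proof (rule lipschitz_onI)
  show "0 \<le> L" using assms(1) by (rule lipschitz_on_nonneg)
  fix x y assume "x \<in> X" "y \<in> X"
  then have "dist (f x) (f y) \<le> L * dist x y" "dist (g x) (g y) \<le> L * dist x y"
    using assms by (auto dest: lipschitz_onD)
  then show "dist (max (f x) (g x)) (max (f y) (g y)) \<le> L * dist x y"
    by (auto simp: dist_real_def max_def abs_le_iff)
qed

lemma lipschitz_on_pointwise_limit:
  fixes f :: "nat \<Rightarrow> 'a::metric_space \<Rightarrow> 'b::metric_space"
  assumes lip: "\<And>m. L-lipschitz_on X (f m)"
    and lim: "\<And>x. x \<in> X \<Longrightarrow> (\<lambda>m. f m x) \<longlonglongrightarrow> g x"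
  shows "L-lipschitz_on X g"
proof (rule lipschitz_onI)
  show "0 \<le> L" using lip by (rule lipschitz_on_nonneg)
  fix x y assume "x \<in> X" "y \<in> X"
  then show "dist (g x) (g y) \<le> L * dist x y"
    by (intro LIMSEQ_le_const2[OF tendsto_dist[OF lim lim]])
      (auto intro: lipschitz_onD[OF lip])
qed

text \<open>The common constant lets the evaluation point move to \<open>y\<close> at cost
  \<open>L * dist (x m) y\<close>; what remains is convergence at the single point
  \<open>y\<close>.\<close>

lemma equi_lipschitz_tendsto_diagonal:
  fixes f :: "nat \<Rightarrow> 'a::metric_space \<Rightarrow> 'b::metric_space"
  assumes lip: "\<And>m. L-lipschitz_on X (f m)"
    and lim: "(\<lambda>m. f m y) \<longlonglongrightarrow> l"
    and x: "\<forall>\<^sub>F m in sequentially. x m \<in> X" "x \<longlonglongrightarrow> y" "y \<in> X"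
  shows "(\<lambda>m. f m (x m)) \<longlonglongrightarrow> l"
proof -
  have "(\<lambda>m. L * dist (x m) y + dist (f m y) l) \<longlonglongrightarrow> L * dist y y + dist l l"
    by (intro tendsto_intros x lim)
  then have bound_lim: "(\<lambda>m. L * dist (x m) y + dist (f m y) l) \<longlonglongrightarrow> 0" by simp
  have bound: "\<forall>\<^sub>F m in sequentially. dist (f m (x m)) l \<le> L * dist (x m) y + dist (f m y) l"
    using x(1)
  proof eventually_elim
    case (elim m)
    then show ?case
      using lipschitz_onD[OF lip elim x(3), of m] dist_triangle[of "f m (x m)" l "f m y"] by linarith
  qed
  have "(\<lambda>m. dist (f m (x m)) l) \<longlonglongrightarrow> 0"
    by (rule tendsto_sandwich[OF _ bound tendsto_const bound_lim]) simp
  then show ?thesis by (rule iffD2[OF tendsto_dist_iff])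
qed

text \<open>Three-term estimate over a finite net of the compact set: pointwise convergence is
  uniform on the net, and the common Lipschitz constant, inherited by \<open>g\<close>, carries it
  to all of \<open>X\<close>.\<close>

lemma equi_lipschitz_uniform_limit:
  fixes f :: "nat \<Rightarrow> 'a::metric_space \<Rightarrow> 'b::metric_space"
  assumes "compact X" and lip: "\<And>m. L-lipschitz_on X (f m)"
    and lim: "\<And>x. x \<in> X \<Longrightarrow> (\<lambda>m. f m x) \<longlonglongrightarrow> g x"
  shows "uniform_limit X f g sequentially"
proof (rule uniform_limitI)
  fix e :: real assume "e > 0"
  have L: "0 \<le> L" using lip by (rule lipschitz_on_nonneg)
  have lipg: "L-lipschitz_on X g" using lip lim by (rule lipschitz_on_pointwise_limit)
  \<comment> \<open>The mesh makes \<open>L * d < e / 3\<close>; the \<open>+ 1\<close> covers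
    \<open>L = 0\<close>.\<close>
  define d where "d = e / (3 * (L + 1))"
  have "d > 0" using L \<open>e > 0\<close> by (simp add: d_def)
  have "L * d < e / 3"
    using L \<open>e > 0\<close> by (simp add: d_def field_simps)
  obtain N where N: "finite N" "N \<subseteq> X" "X \<subseteq> (\<Union>x\<in>N. ball x d)"
    using seq_compact_imp_totally_bounded[OF compact_imp_seq_compact[OF \<open>compact X\<close>]] \<open>d > 0\<close> by meson
  have "\<forall>\<^sub>F m in sequentially. \<forall>x\<in>N. dist (f m x) (g x) < e / 3"
    using N \<open>e > 0\<close> by (intro eventually_ball_finite ballI tendstoD[OF lim]) auto
  then show "\<forall>\<^sub>F m in sequentially. \<forall>x\<in>X. dist (f m x) (g x) < e"
  proof eventually_elim
    case (elim m)
    show ?case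
    proof
      fix x assume "x \<in> X"
      then obtain y where y: "y \<in> N" "dist y x < d" using N by auto
      then have "y \<in> X" using N by auto
      have "dist (f m x) (f m y) \<le> L * dist x y" "dist (g y) (g x) \<le> L * dist x y"
        using lipschitz_onD[OF lip \<open>x \<in> X\<close> \<open>y \<in> X\<close>] lipschitz_onD[OF lipg \<open>x \<in> X\<close> \<open>y \<in> X\<close>]
        by (auto simp: dist_commute)
      moreover have "L * dist x y \<le> L * d"
        using L y by (intro mult_left_mono) (auto simp: dist_commute)
      moreover have "dist (f m y) (g y) < e / 3" using elim y by auto
      ultimately show "dist (f m x) (g x) < e"
        using \<open>L * d < e / 3\<close> dist_triangle[of "f m x" "g x" "f m y"]
          dist_triangle[of "f m y" "g x" "g y"] by linarith
    qed
  qed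
qed

section \<open>Extraction of a common subsequence\<close>

text \<open>There are finitely many sequences, so it suffices to extract one after the other: each
  refinement preserves the limits already obtained.\<close>

lemma compact_common_subsequence:
  fixes f :: "nat \<Rightarrow> nat \<Rightarrow> 'a::first_countable_topology"
  assumes "compact S" and f: "\<And>i k. k < n \<Longrightarrow> f i k \<in> S"
  obtains s l where "strict_mono (s :: nat \<Rightarrow> nat)"
    and "\<And>k. k < n \<Longrightarrow> l k \<in> S \<and> (\<lambda>i. f (s i) k) \<longlonglongrightarrow> l k"
proof -
  have "\<exists>s l. strict_mono (s :: nat \<Rightarrow> nat) \<and> (\<forall>k<n. l k \<in> S \<and> (\<lambda>i. f (s i) k) \<longlonglongrightarrow> l k)"
    using f
  proof (induction n)
    case 0
    then show ?case by (intro exI[of _ id]) (simp add: strict_mono_def)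
  next
    case (Suc n)
    from Suc.IH[OF Suc.prems[OF less_SucI]] obtain s l where s: "strict_mono (s :: nat \<Rightarrow> nat)"
      and l: "\<forall>k<n. l k \<in> S \<and> (\<lambda>i. f (s i) k) \<longlonglongrightarrow> l k" by blast
    obtain a t where a: "a \<in> S" and t: "strict_mono (t :: nat \<Rightarrow> nat)"
      and ta: "((\<lambda>i. f (s i) n) \<circ> t) \<longlonglongrightarrow> a"
      using seq_compactE[OF compact_imp_seq_compact[OF \<open>compact S\<close>], of "\<lambda>i. f (s i) n"] Suc.prems
      by auto
    have "(\<lambda>i. f ((s \<circ> t) i) k) \<longlonglongrightarrow> (l(n := a)) k" if "k < Suc n" for k
    proof (cases "k = n")
      case False
      then show ?thesis using l that LIMSEQ_subseq_LIMSEQ[OF _ t, of "\<lambda>i. f (s i) k"]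
        by (auto simp: o_def)
    qed (use ta in \<open>simp add: o_def\<close>)
    moreover have "(l(n := a)) k \<in> S" if "k < Suc n" for k
      using l a that by (auto simp: less_Suc_eq)
    ultimately show ?case using strict_mono_o[OF s t] by blast
  qed
  then show ?thesis using that by blast
qed

section \<open>Finite maxima and quadratic cuts\<close>

lemma fmax_ge: "finite W \<Longrightarrow> w \<in> W \<Longrightarrow> w x \<le> fmax W x"
  by (simp add: fmax_def)

lemma fmax_insert:
  "finite W \<Longrightarrow> W \<noteq> {} \<Longrightarrow> fmax (insert w W) x = max (w x) (fmax W x)"
  by (simp add: fmax_def)

lemma quad_centre [simp]: "quad c \<beta> p a a = \<beta>"
  by (simp add: quad_def)

text \<open>The constant bounds the gradient \<open>p - c (x - a)\<close> within distance
  \<open>D\<close> of \<open>a\<close>; it is obtained by factoring the difference of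
  squares.\<close>

lemma quad_lipschitz_on:
  fixes X :: "'a::real_inner set"
  assumes D: "\<And>x. x \<in> X \<Longrightarrow> norm (x - a) \<le> D" and "D \<ge> 0" and "norm p \<le> P"
  shows "(P + \<bar>c\<bar> * D)-lipschitz_on X (quad c \<beta> p a)"
proof (rule lipschitz_onI)
  show "0 \<le> P + \<bar>c\<bar> * D"
    using assms norm_ge_zero[of p] by (intro add_nonneg_nonneg) (linarith, simp)
  fix x y assume xy: "x \<in> X" "y \<in> X"
  define n m where "n = norm (x - a)" and "m = norm (y - a)"
  have nm: "n \<le> D" "m \<le> D" "0 \<le> n" "0 \<le> m" using D xy by (auto simp: n_def m_def)
  have "\<bar>n - m\<bar> \<le> norm (x - y)"
    using norm_triangle_ineq3[of "x - a" "y - a"] by (simp add: n_def m_def)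
  then have "\<bar>n - m\<bar> * (n + m) \<le> norm (x - y) * (2 * D)"
    using nm by (intro mult_mono) auto
  then have "\<bar>n\<^sup>2 - m\<^sup>2\<bar> \<le> norm (x - y) * (2 * D)"
    using nm by (simp add: power2_eq_square square_diff_square_factored abs_mult mult.commute)
  then have "\<bar>c\<bar> / 2 * \<bar>n\<^sup>2 - m\<^sup>2\<bar> \<le> \<bar>c\<bar> / 2 * (norm (x - y) * (2 * D))"
    by (intro mult_left_mono) auto
  moreover have "\<bar>p \<bullet> (x - y)\<bar> \<le> P * norm (x - y)"
    by (meson Cauchy_Schwarz_ineq2 assms(3) mult_right_mono norm_ge_zero order_trans)
  moreover have "quad c \<beta> p a x - quad c \<beta> p a y = p \<bullet> (x - y) - c / 2 * (n\<^sup>2 - m\<^sup>2)"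
    by (simp add: quad_def n_def m_def algebra_simps)
  then have "\<bar>quad c \<beta> p a x - quad c \<beta> p a y\<bar> \<le> \<bar>p \<bullet> (x - y)\<bar> + \<bar>c\<bar> / 2 * \<bar>n\<^sup>2 - m\<^sup>2\<bar>"
    using abs_triangle_ineq4[of "p \<bullet> (x - y)" "c / 2 * (n\<^sup>2 - m\<^sup>2)"] by (simp add: abs_mult)
  ultimately show "dist (quad c \<beta> p a x) (quad c \<beta> p a y) \<le> (P + \<bar>c\<bar> * D) * dist x y"
    by (simp add: dist_real_def dist_norm algebra_simps)
qed

text \<open>Evaluate the quadratic one unit away in the direction of its slope, at
  \<open>a + sgn p\<close>: there the linear term is \<open>norm p\<close> and the quadratic term
  costs only \<open>c / 2\<close>.\<close>

lemma quad_slope_bound: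
  assumes "\<And>z. z \<in> cball a 1 \<Longrightarrow> quad c \<beta> p a z \<le> M"
  shows "norm p \<le> M - \<beta> + \<bar>c\<bar> / 2"
\<comment> \<open>For \<open>p = 0\<close> there is no direction to move in; the centre alone gives
  \<open>\<beta> \<le> M\<close>.\<close>
proof (cases "p = 0")
  case True
  then show ?thesis using assms[of a] by (simp add: add_nonneg_nonneg)
next
  case False
  then have "quad c \<beta> p a (a + sgn p) \<le> M"
    by (intro assms) (simp add: dist_norm norm_sgn)
  moreover have "p \<bullet> sgn p = norm p"
    using False by (simp add: sgn_div_norm dot_square_norm power2_eq_square)
  ultimately show ?thesis using False by (simp add: quad_def norm_sgn)
qed

section \<open>The Bellman supremum and greedy controls\<close>

text \<open>Boundedness above on compact sets is the property of \<open>\<psi>\<close> that the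
  Bellman operator passes on: \<open>F\<close> maps the compact \<open>C \<times> U\<close> to a
  compact set, where the bound for \<open>\<psi>\<close> applies.\<close>

lemma bellman_maximand_bdd_above:
  fixes C :: "'a::topological_space set" and U :: "'b::topological_space set"
    and F :: "'a \<Rightarrow> 'b \<Rightarrow> 'a" and \<psi> :: "'a \<Rightarrow> real"
  assumes C: "compact C" and U: "compact U"
    and F: "continuous_on (UNIV \<times> U) (\<lambda>(x, u). F x u)"
    and ell: "continuous_on (UNIV \<times> U) (\<lambda>(x, u). ell x u)"
    and \<psi>: "\<And>C. compact C \<Longrightarrow> bdd_above (\<psi> ` C)"
  shows "bdd_above ((\<lambda>(x, u). h * ell x u + \<psi> (F x u)) ` (C \<times> U))"
proof -
  have CU: "compact (C \<times> U)" "C \<times> U \<subseteq> UNIV \<times> U" using C U by (auto intro: compact_Times)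
  have "compact ((\<lambda>(x, u). F x u) ` (C \<times> U))"
    using CU F by (blast intro: compact_continuous_image continuous_on_subset)
  then have "bdd_above (\<psi> ` (\<lambda>(x, u). F x u) ` (C \<times> U))" by (rule \<psi>)
  then obtain M where M: "\<And>x u. x \<in> C \<Longrightarrow> u \<in> U \<Longrightarrow> \<psi> (F x u) \<le> M"
    unfolding bdd_above_def by fast
  have "continuous_on (C \<times> U) (\<lambda>z. h * (case z of (x, u) \<Rightarrow> ell x u))"
    by (rule continuous_on_mult_left[OF continuous_on_subset[OF ell CU(2)]])
  then have "compact ((\<lambda>z. h * (case z of (x, u) \<Rightarrow> ell x u)) ` (C \<times> U))"
    using CU by (blast intro: compact_continuous_image)
  then have "bdd_above ((\<lambda>z. h * (case z of (x, u) \<Rightarrow> ell x u)) ` (C \<times> U))"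
    by (intro bounded_imp_bdd_above compact_imp_bounded)
  then obtain N where N: "\<And>x u. x \<in> C \<Longrightarrow> u \<in> U \<Longrightarrow> h * ell x u \<le> N"
    unfolding bdd_above_def by auto
  show ?thesis
    by (rule bdd_aboveI[of _ "N + M"]) (auto intro: add_mono M N)
qed

lemma bdd_above_bellman_image:
  assumes "U \<noteq> {}"
    and "bdd_above ((\<lambda>(x, u). h * ell x u + \<psi> (F x u)) ` (C \<times> U))"
  shows "bdd_above (bellman h ell F U \<psi> ` C)"
proof -
  obtain M where "\<And>x u. x \<in> C \<Longrightarrow> u \<in> U \<Longrightarrow> h * ell x u + \<psi> (F x u) \<le> M"
    using assms(2) unfolding bdd_above_def by fast
  then show ?thesis
    using \<open>U \<noteq> {}\<close> by (intro bdd_aboveI[of _ M]) (auto simp: bellman_def intro!: cSUP_least)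
qed

lemma greedyD:
  assumes "greedy h ell F U \<psi> x u"
  shows "u \<in> U" and "u' \<in> U \<Longrightarrow> h * ell x u' + \<psi> (F x u') \<le> h * ell x u + \<psi> (F x u)"
  using assms by (auto simp: greedy_def is_arg_max_def not_less)

lemma greedyI:
  assumes "u \<in> U" and "\<And>u'. u' \<in> U \<Longrightarrow> h * ell x u' + \<psi> (F x u') \<le> h * ell x u + \<psi> (F x u)"
  shows "greedy h ell F U \<psi> x u"
  using assms by (auto simp: greedy_def is_arg_max_def not_less)

text \<open>The supremum is a maximum attained at \<open>u\<close>, which also bounds the
  set.\<close>

lemma bellman_greedy:
  assumes "greedy h ell F U \<psi> x u"
  shows "bellman h ell F U \<psi> x = h * ell x u + \<psi> (F x u)"
  unfolding bellman_def using greedyD[OF assms] by (intro cSup_eq_maximum) auto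

section \<open>A fixed run of the algorithm\<close>

text \<open>\<open>W\<close>, \<open>xt\<close> and \<open>uf\<close> are arbitrary subject to the
  relation defining the algorithm, so what follows holds for every admissible choice of controls,
  active functions and slopes.\<close>

locale trajectory_run =
  fixes h :: real
    and ell :: "'a::euclidean_space \<Rightarrow> 'b::metric_space \<Rightarrow> real"
    and F :: "'a \<Rightarrow> 'b \<Rightarrow> 'a"
    and U :: "'b set" and X :: "'a set"
    and K :: nat and c :: "nat \<Rightarrow> real"
    and \<phi> :: "'a \<Rightarrow> real" and v :: "nat \<Rightarrow> 'a \<Rightarrow> real" and x0 :: 'a
    and W :: "nat \<Rightarrow> nat \<Rightarrow> ('a \<Rightarrow> real) set"
    and xt :: "nat \<Rightarrow> nat \<Rightarrow> 'a" and uf :: "nat \<Rightarrow> nat \<Rightarrow> 'b"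
  assumes U: "U \<noteq> {}" "compact U"
    and phi_cont: "continuous_on UNIV \<phi>"
    and X: "compact X"
    and F_in_X: "\<And>x u. x \<in> X \<Longrightarrow> u \<in> U \<Longrightarrow> F x u \<in> X"
    and F_cont: "continuous_on (UNIV \<times> U) (\<lambda>(x, u). F x u)"
    and ell_cont: "continuous_on (UNIV \<times> U) (\<lambda>(x, u). ell x u)"
    and v_K: "v K = \<phi>"
    and v_step: "\<And>k. k < K \<Longrightarrow> v k = bellman h ell F U (v (Suc k))"
    and alg: "trajectory_algorithm h ell F U K c \<phi> v x0 W xt uf"
    and xt_0_in_X: "\<And>k. k \<le> K \<Longrightarrow> xt 0 k \<in> X"
    and init_lipschitz: "\<And>k. k \<le> K \<Longrightarrow> \<exists>L. L-lipschitz_on X (fmax (W 0 k))"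
    and init_subsolution: "\<And>k x. k < K \<Longrightarrow> x \<in> X \<Longrightarrow>
      fmax (W 0 k) x \<le> bellman h ell F U (fmax (W 0 (Suc k))) x"
begin

abbreviation vh :: "nat \<Rightarrow> nat \<Rightarrow> 'a \<Rightarrow> real" where
  "vh m k \<equiv> fmax (W m k)"

lemma vh_K: "vh m K = \<phi>"
  using alg by (simp add: trajectory_algorithm_def)

lemma family: "k \<le> K \<Longrightarrow> finite (W m k)" "k \<le> K \<Longrightarrow> W m k \<noteq> {}"
  using alg by (auto simp: trajectory_algorithm_def basis_family_def)

lemma forward_greedy:
  assumes "m \<ge> 1" and "k < K"
  shows "greedy h ell F U (vh m (Suc k)) (xt m k) (uf m k)"
    and "xt m (Suc k) = F (xt m k) (uf m k)"
  using alg assms by (auto simp: trajectory_algorithm_def)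

lemma xt_in_X: "k \<le> K \<Longrightarrow> xt m k \<in> X"
proof (induction k)
  case 0
  have "xt m 0 = xt 0 0" using alg by (simp add: trajectory_algorithm_def)
  then show ?case using xt_0_in_X by simp
next
  case (Suc k)
  show ?case
  \<comment> \<open>Iteration 0 has no forward step, so its points lie in \<open>X\<close> by
    hypothesis; later points are images under greedy controls.\<close>
  proof (cases "m = 0")
    case False
    then show ?thesis
      using Suc forward_greedy[of m k] by (auto intro: F_in_X greedyD)
  qed (use Suc.prems xt_0_in_X in auto)
qed

text \<open>Backward induction from the continuous terminal reward. The bound is for every compact
  set, since slopes are later controlled on a neighbourhood of \<open>X\<close> that may leave
  \<open>X\<close>.\<close>

lemma v_bdd_above: "k \<le> K \<Longrightarrow> compact C \<Longrightarrow> bdd_above (v k ` C)"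
proof (induction k arbitrary: C rule: inc_induct)
  case base
  then have "compact (\<phi> ` C)"
    using phi_cont by (blast intro: compact_continuous_image continuous_on_subset)
  then show ?case by (simp add: v_K bounded_imp_bdd_above compact_imp_bounded)
next
  case (step k)
  have "bdd_above ((\<lambda>(x, u). h * ell x u + v (Suc k) (F x u)) ` (C \<times> U))"
    using step U F_cont ell_cont by (intro bellman_maximand_bdd_above) auto
  then show ?case
    using step U by (simp add: v_step bdd_above_bellman_image)
qed

section \<open>Comparison with the Bellman operator\<close>

text \<open>A real \<open>SUP\<close> dominates its members only over a set bounded above;
  domination by \<open>v (Suc k)\<close> supplies that bound, as the successors of \<open>x\<close>
  form a compact set.\<close>

lemma le_bellman:
  assumes k: "k < K" and \<psi>: "\<And>y. \<psi> y \<le> v (Suc k) y"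
    and "u \<in> U" and le: "a \<le> h * ell x u + \<psi> (F x u)"
  shows "a \<le> bellman h ell F U \<psi> x"
proof -
  have "bdd_above ((\<lambda>(x, u). h * ell x u + v (Suc k) (F x u)) ` ({x} \<times> U))"
    using k U F_cont ell_cont by (intro bellman_maximand_bdd_above) (auto intro: v_bdd_above)
  then obtain M where M: "\<And>u. u \<in> U \<Longrightarrow> h * ell x u + v (Suc k) (F x u) \<le> M"
    unfolding bdd_above_def by fast
  have "bdd_above ((\<lambda>u. h * ell x u + \<psi> (F x u)) ` U)"
  proof (rule bdd_aboveI2)
    fix u assume "u \<in> U"
    then show "h * ell x u + \<psi> (F x u) \<le> M" using M[of u] \<psi>[of "F x u"] by simp
  qed
  from \<open>u \<in> U\<close> this have "h * ell x u + \<psi> (F x u) \<le> bellman h ell F U \<psi> x"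
    unfolding bellman_def by (rule cSUP_upper)
  then show ?thesis using le by simp
qed

lemma bellman_mono:
  assumes "k < K" and "\<And>y. \<psi>' y \<le> v (Suc k) y" and "\<And>u. u \<in> U \<Longrightarrow> \<psi> (F x u) \<le> \<psi>' (F x u)"
  shows "bellman h ell F U \<psi> x \<le> bellman h ell F U \<psi>' x"
  \<comment> \<open>Only the left side is opened: its supremum is bounded member by member, and the
    boundedness required on the right comes from the bound on \<open>\<psi>'\<close>.\<close>
  unfolding bellman_def[of _ _ _ _ \<psi>]
proof (rule cSUP_least[OF U(1)])
  fix u assume "u \<in> U"
  then show "h * ell x u + \<psi> (F x u) \<le> bellman h ell F U \<psi>' x"
    using assms(3) by (intro le_bellman[OF assms(1,2)]) auto
qed

section \<open>Cuts and the invariants of the iterates\<close>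

text \<open>The active basis function touches the maximum at the successor of the trajectory point
  and lies below it elsewhere. Hence it can be replaced by \<open>vh m (Suc k)\<close>, with
  equality at the base point, and later arguments see only the iterates.\<close>

lemma backward_cut:
  assumes k: "k < K"
  obtains u p \<beta> where "greedy h ell F U (vh m (Suc k)) (xt m k) u"
    and "\<beta> = h * ell (xt m k) u + vh m (Suc k) (F (xt m k) u)"
    and "\<And>z. quad (c k) \<beta> p (xt m k) z \<le> h * ell z u + vh m (Suc k) (F z u)"
    and "\<And>z. vh (Suc m) k z = max (quad (c k) \<beta> p (xt m k) z) (vh m k z)"
proof -
  have "backward_step h ell F U (c k) (xt m k) (W m (Suc k)) (W m k) (W (Suc m) k)"
    using alg k by (simp add: trajectory_algorithm_def)
  then obtain u w p where g: "greedy h ell F U (vh m (Suc k)) (xt m k) u"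
    and w: "w \<in> W m (Suc k)" "w (F (xt m k) u) = vh m (Suc k) (F (xt m k) u)"
    and le: "\<And>z. quad (c k) (h * ell (xt m k) u + w (F (xt m k) u)) p (xt m k) z
                \<le> h * ell z u + w (F z u)"
    and W: "W (Suc m) k = insert (quad (c k) (h * ell (xt m k) u + w (F (xt m k) u)) p (xt m k)) (W m k)"
    unfolding backward_step_def by blast
  show ?thesis
  proof (rule that[OF g refl])
    fix z
    have "w (F z u) \<le> vh m (Suc k) (F z u)"
      using w k family(1)[of "Suc k" m] by (auto intro: fmax_ge)
    then show "quad (c k) (h * ell (xt m k) u + vh m (Suc k) (F (xt m k) u)) p (xt m k) z
        \<le> h * ell z u + vh m (Suc k) (F z u)"
      using le[of z] w(2) by simp
    show "vh (Suc m) k z = max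
        (quad (c k) (h * ell (xt m k) u + vh m (Suc k) (F (xt m k) u)) p (xt m k) z) (vh m k z)"
      using k w(2) by (simp add: W fmax_insert family)
  qed
qed

text \<open>Induction on \<open>m\<close> for all \<open>k\<close> at once, because a cut at time
  \<open>k\<close> is built from the iterate at \<open>Suc k\<close>: it lies below the reward of a
  single control followed by \<open>v (Suc k)\<close>, hence below \<open>v k\<close>.\<close>

lemma vh_le_v: "k \<le> K \<Longrightarrow> vh m k x \<le> v k x"
proof (induction m arbitrary: k x)
  case 0
  then show ?case using alg by (simp add: trajectory_algorithm_def)
next
  case (Suc m)
  show ?case
  proof (cases "k = K")
    case True
    then show ?thesis by (simp add: vh_K v_K)
  next
    case False
    then have k: "k < K" using Suc by simp
    obtain u p \<beta> where u: "greedy h ell F U (vh m (Suc k)) (xt m k) u"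
      and q: "\<And>z. quad (c k) \<beta> p (xt m k) z \<le> h * ell z u + vh m (Suc k) (F z u)"
      and vh: "\<And>z. vh (Suc m) k z = max (quad (c k) \<beta> p (xt m k) z) (vh m k z)"
      using backward_cut[OF k] by metis
    have "quad (c k) \<beta> p (xt m k) x \<le> h * ell x u + v (Suc k) (F x u)"
      using q[of x] Suc.IH[of "Suc k" "F x u"] k by linarith
    then have "quad (c k) \<beta> p (xt m k) x \<le> v k x"
      unfolding v_step[OF k] using k u by (intro le_bellman[of k]) (auto dest: greedyD)
    then show ?thesis using vh Suc.IH[of k x] Suc.prems by simp
  qed
qed

lemma vh_incseq:
  assumes "k \<le> K"
  shows "incseq (\<lambda>m. vh m k x)"
proof (rule incseq_SucI)
  fix m
  show "vh m k x \<le> vh (Suc m) k x"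
  proof (cases "k = K")
    case False
    then have "k < K" using assms by simp
    from backward_cut[OF this, of m] show ?thesis by (metis max.cobounded2)
  qed (simp add: vh_K)
qed

text \<open>A new cut lies below the maximand for one control, hence below the Bellman value of the
  old iterate at \<open>Suc k\<close>; this value can only grow when that iterate is
  updated.\<close>

lemma vh_subsolution: "k < K \<Longrightarrow> x \<in> X \<Longrightarrow> vh m k x \<le> bellman h ell F U (vh m (Suc k)) x"
proof (induction m)
  case 0
  then show ?case by (rule init_subsolution)
next
  case (Suc m)
  note k = \<open>k < K\<close>
  obtain u p \<beta> where u: "greedy h ell F U (vh m (Suc k)) (xt m k) u"
    and q: "\<And>z. quad (c k) \<beta> p (xt m k) z \<le> h * ell z u + vh m (Suc k) (F z u)"
    and vh: "\<And>z. vh (Suc m) k z = max (quad (c k) \<beta> p (xt m k) z) (vh m k z)"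
    using backward_cut[OF k] by metis
  have "quad (c k) \<beta> p (xt m k) x \<le> bellman h ell F U (vh m (Suc k)) x"
    using k u q by (intro le_bellman[of k]) (auto dest: greedyD intro: vh_le_v)
  then have "vh (Suc m) k x \<le> bellman h ell F U (vh m (Suc k)) x"
    using vh Suc by simp
  also have "\<dots> \<le> bellman h ell F U (vh (Suc m) (Suc k)) x"
    using k vh_incseq[of "Suc k"]
    by (intro bellman_mono[of k]) (auto intro: vh_le_v dest: incseq_SucD)
  finally show ?case .
qed

text \<open>A slope at a base point in \<open>X\<close> is bounded because the cut lies below \<open>v k\<close> on the whole unit
  ball around that point (not only on \<open>X\<close>, whose interior may be empty), while its value at the
  base point is at least that of the initial function.\<close>

lemma vh_equi_lipschitz:
  assumes "k \<le> K"
  shows "\<exists>L. \<forall>m. L-lipschitz_on X (vh m k)"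
proof (cases "k = K")
  case True
  then show ?thesis using init_lipschitz[of K] by (simp add: vh_K)
next
  case False
  then have k: "k < K" using assms by simp
  obtain L0 where L0: "L0-lipschitz_on X (vh 0 k)" using init_lipschitz[OF assms] by auto
  have "compact (vh 0 k ` X)"
    using X lipschitz_on_continuous_on[OF L0] by (rule compact_continuous_image[rotated])
  then have "bdd_below (vh 0 k ` X)" by (intro bounded_imp_bdd_below compact_imp_bounded)
  then obtain N where N: "\<And>x. x \<in> X \<Longrightarrow> N \<le> vh 0 k x" unfolding bdd_below_def by fast
  \<comment> \<open>The unit neighbourhood of \<open>X\<close>, as a Minkowski sum, is compact, so
    one \<open>M\<close> bounds \<open>v k\<close> on it.\<close>
  have "compact {x + y |x y. x \<in> X \<and> y \<in> cball (0::'a) 1}"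
    using X by (intro compact_sums) auto
  from v_bdd_above[OF assms this]
  obtain M where M: "\<And>x y. x \<in> X \<Longrightarrow> y \<in> cball 0 1 \<Longrightarrow> v k (x + y) \<le> M"
    unfolding bdd_above_def by blast
  have X': "norm (x - y) \<le> diameter X" if "x \<in> X" "y \<in> X" for x y
    using diameter_bounded_bound[OF compact_imp_bounded[OF X] that] by (simp add: dist_norm)
  \<comment> \<open>The first entry serves the initial function; the second is the constant of
    \<open>quad_lipschitz_on\<close> for the slope bound \<open>M - N + |c k| / 2\<close> and the
    radius \<open>diameter X\<close>. Neither depends on \<open>m\<close>.\<close>
  define L where "L = max L0 ((M - N + \<bar>c k\<bar> / 2) + \<bar>c k\<bar> * diameter X)"
  have "L-lipschitz_on X (vh m k)" for m
  proof (induction m)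
    case 0
    show ?case using L0 by (rule lipschitz_on_mono) (auto simp: L_def)
  next
    case (Suc m)
    let ?a = "xt m k"
    have a: "?a \<in> X" using assms by (rule xt_in_X)
    obtain u p \<beta> where u: "greedy h ell F U (vh m (Suc k)) ?a u"
      and \<beta>: "\<beta> = h * ell ?a u + vh m (Suc k) (F ?a u)"
      and vh: "\<And>z. vh (Suc m) k z = max (quad (c k) \<beta> p ?a z) (vh m k z)"
      using backward_cut[OF k] by metis
    have "quad (c k) \<beta> p ?a z \<le> M" if "z \<in> cball ?a 1" for z
    proof -
      \<comment> \<open>The cut is part of the next iterate, which stays below
        \<open>v k\<close>.\<close>
      have "quad (c k) \<beta> p ?a z \<le> v k z" using vh[of z] vh_le_v[OF assms, of "Suc m" z] by simp
      also have "\<dots> \<le> M" using M[OF a, of "z - ?a"] that by (simp add: dist_norm norm_minus_commute)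
      finally show ?thesis .
    qed
    then have "norm p \<le> M - \<beta> + \<bar>c k\<bar> / 2" by (rule quad_slope_bound)
    \<comment> \<open>\<open>N \<le> vh 0 k ?a \<le> vh m k ?a\<close>, which is at most the Bellman
      value of \<open>vh m (Suc k)\<close> at \<open>?a\<close>; this value is
      \<open>\<beta>\<close> since \<open>u\<close> is greedy. The slope bound thereby becomes free
      of \<open>\<beta>\<close>.\<close>
    moreover have "N \<le> \<beta>"
      using N[OF a] incseqD[OF vh_incseq[OF assms], of 0 m ?a] vh_subsolution[OF k a, of m]
        bellman_greedy[OF u] \<beta> by simp
    ultimately have "((M - N + \<bar>c k\<bar> / 2) + \<bar>c k\<bar> * diameter X)-lipschitz_on X (quad (c k) \<beta> p ?a)"
      using X' a by (intro quad_lipschitz_on diameter_ge_0 compact_imp_bounded X) auto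
    then have "L-lipschitz_on X (quad (c k) \<beta> p ?a)"
      by (rule lipschitz_on_mono) (auto simp: L_def)
    from lipschitz_on_max[OF this Suc.IH] show ?case by (simp add: vh fun_eq_iff)
  qed
  then show ?thesis by blast
qed

section \<open>The limit functions\<close>

text \<open>\<open>lim\<close> is arbitrary for divergent sequences; for \<open>k \<le> K\<close>
  the increasing iterates are bounded by \<open>v k x\<close>, so the limit exists at every point of
  the space.\<close>

definition vstar :: "nat \<Rightarrow> 'a \<Rightarrow> real" where
  "vstar k x = lim (\<lambda>m. vh m k x)"

lemma vstar_tendsto:
  assumes "k \<le> K"
  shows "(\<lambda>m. vh m k x) \<longlonglongrightarrow> vstar k x"
proof -
  have "convergent (\<lambda>m. vh m k x)"
    using incseq_convergent[OF vh_incseq[OF assms], of x "v k x"] vh_le_v[OF assms]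
    by (metis convergent_def)
  then show ?thesis by (simp add: vstar_def convergent_LIMSEQ_iff)
qed

lemma vh_le_vstar: "k \<le> K \<Longrightarrow> vh m k x \<le> vstar k x"
  by (rule incseq_le[OF vh_incseq vstar_tendsto])

lemma vstar_le_v: "k \<le> K \<Longrightarrow> vstar k x \<le> v k x"
  by (rule LIMSEQ_le_const2[OF vstar_tendsto]) (simp_all add: vh_le_v)

lemma vstar_lipschitz:
  assumes "k \<le> K"
  shows "\<exists>L. L-lipschitz_on X (vstar k)"
proof -
  obtain L where "\<And>m. L-lipschitz_on X (vh m k)" using vh_equi_lipschitz[OF assms] by blast
  from lipschitz_on_pointwise_limit[OF this vstar_tendsto[OF assms]] show ?thesis ..
qed

lemma vstar_uniform_limit:
  assumes "k \<le> K"
  shows "uniform_limit X (\<lambda>m. vh m k) (vstar k) sequentially"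
proof -
  obtain L where "\<And>m. L-lipschitz_on X (vh m k)" using vh_equi_lipschitz[OF assms] by blast
  from equi_lipschitz_uniform_limit[OF X this vstar_tendsto[OF assms]] show ?thesis .
qed

text \<open>On the right the iterate is replaced by the larger \<open>vstar (Suc k)\<close> before
  the limit is taken, so the right side is constant in \<open>m\<close> and monotonicity of the
  Bellman operator suffices.\<close>

lemma vstar_subsolution:
  assumes "k < K" and "x \<in> X"
  shows "vstar k x \<le> bellman h ell F U (vstar (Suc k)) x"
proof (rule LIMSEQ_le_const2[OF vstar_tendsto])
  have "vh m k x \<le> bellman h ell F U (vstar (Suc k)) x" for m
  proof -
    note vh_subsolution[OF assms, of m]
    also have "bellman h ell F U (vh m (Suc k)) x \<le> bellman h ell F U (vstar (Suc k)) x"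
      using assms(1) by (intro bellman_mono[of k] vstar_le_v vh_le_vstar) simp_all
    finally show ?thesis .
  qed
  then show "\<exists>N. \<forall>m\<ge>N. vh m k x \<le> bellman h ell F U (vstar (Suc k)) x" by blast
qed (use assms in simp)

section \<open>Limits of trajectories and forward controls\<close>

text \<open>The index sequence \<open>r\<close> may be any that tends to infinity, as it stands both
  for a subsequence \<open>t\<close> and for the shifted indices \<open>Suc (t i)\<close>.\<close>

lemma vh_tendsto_diagonal:
  assumes "k \<le> K" and "filterlim r at_top sequentially"
    and "\<And>i. x i \<in> X" and "x \<longlonglongrightarrow> y" and "y \<in> X"
  shows "(\<lambda>i. vh (r i) k (x i)) \<longlonglongrightarrow> vstar k y"
proof -
  obtain L where L: "\<And>m. L-lipschitz_on X (vh m k)" using vh_equi_lipschitz[OF assms(1)] by auto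
  have lim: "(\<lambda>i. vh (r i) k y) \<longlonglongrightarrow> vstar k y"
    using vstar_tendsto[OF assms(1)] assms(2) by (rule filterlim_compose)
  show ?thesis
    by (rule equi_lipschitz_tendsto_diagonal[OF L lim _ assms(4,5)]) (simp add: assms(3))
qed

lemma tendsto_on_U:
  assumes "continuous_on (UNIV \<times> U) (\<lambda>(x, u). f x u)"
    and "x \<longlonglongrightarrow> y" and "w \<longlonglongrightarrow> u" and "\<And>i. w i \<in> U" and "u \<in> U"
  shows "(\<lambda>i. f (x i) (w i)) \<longlonglongrightarrow> f y u"
  using continuous_on_tendsto_compose[OF assms(1) tendsto_Pair[OF assms(2,3)]] assms(4,5) by simp

text \<open>Optimality of the forward controls passes to the limit against each fixed competitor.
  The value equation combines two inequalities: \<open>\<le>\<close> from the subsolution property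
  of the limit, \<open>\<ge>\<close> from the cuts added at the trajectory points.\<close>

lemma limit_trajectory:
  fixes t :: "nat \<Rightarrow> nat"
  assumes k: "k < K" and t: "strict_mono t" "\<And>i. t i \<ge> 1"
    and x: "(\<lambda>i. xt (t i) k) \<longlonglongrightarrow> x" and y: "(\<lambda>i. xt (t i) (Suc k)) \<longlonglongrightarrow> y"
    and u: "(\<lambda>i. uf (t i) k) \<longlonglongrightarrow> u"
  shows "u \<in> U" and "y = F x u" and "greedy h ell F U (vstar (Suc k)) x u"
    and "vstar k x = h * ell x u + vstar (Suc k) y"
proof -
  note fwd = forward_greedy[OF t(2) k]
  have ufU: "uf (t i) k \<in> U" for i using greedyD(1)[OF fwd(1)] .
  show uU: "u \<in> U"
    using closed_sequentially[OF compact_imp_closed[OF U(2)] _ u] ufU by blast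
  have xX: "x \<in> X"
    using closed_sequentially[OF compact_imp_closed[OF X] _ x] xt_in_X k by simp
  have "(\<lambda>i. F (xt (t i) k) (uf (t i) k)) \<longlonglongrightarrow> F x u"
    using F_cont x u ufU uU by (rule tendsto_on_U)
  then show yF: "y = F x u"
    using y fwd(2) by (simp add: LIMSEQ_unique)
  have tt: "filterlim t at_top sequentially" using t(1) by (rule filterlim_subseq)
  \<comment> \<open>Any convergent sequence of controls is allowed: the forward controls and, as a
    constant sequence, each competitor.\<close>
  have value_lim: "(\<lambda>i. h * ell (xt (t i) k) (w i) + vh (t i) (Suc k) (F (xt (t i) k) (w i)))
      \<longlonglongrightarrow> h * ell x u' + vstar (Suc k) (F x u')"
    if "w \<longlonglongrightarrow> u'" "\<And>i. w i \<in> U" "u' \<in> U" for w u'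
    using that k xX
    by (intro tendsto_add tendsto_mult tendsto_const tendsto_on_U[OF ell_cont x]
        vh_tendsto_diagonal tt tendsto_on_U[OF F_cont x]) (auto intro!: F_in_X xt_in_X)
  note opt_lim = value_lim[OF u ufU uU]
  show g: "greedy h ell F U (vstar (Suc k)) x u"
  proof (rule greedyI[OF uU])
    fix u' assume "u' \<in> U"
    then show "h * ell x u' + vstar (Suc k) (F x u') \<le> h * ell x u + vstar (Suc k) (F x u)"
      using greedyD(2)[OF fwd(1)]
      by (intro LIMSEQ_le[OF value_lim[OF tendsto_const] opt_lim]) auto
  qed
  \<comment> \<open>The next backward step adds a cut at \<open>xt (t i) k\<close> attaining the value of the forward control.\<close>
  have "h * ell (xt (t i) k) (uf (t i) k) + vh (t i) (Suc k) (F (xt (t i) k) (uf (t i) k))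
      \<le> vh (Suc (t i)) k (xt (t i) k)" for i
  proof -
    obtain u' p \<beta> where u': "greedy h ell F U (vh (t i) (Suc k)) (xt (t i) k) u'"
      and \<beta>: "\<beta> = h * ell (xt (t i) k) u' + vh (t i) (Suc k) (F (xt (t i) k) u')"
      and vh: "\<And>z. vh (Suc (t i)) k z = max (quad (c k) \<beta> p (xt (t i) k) z) (vh (t i) k z)"
      using backward_cut[OF k] by metis
    show ?thesis using vh[of "xt (t i) k"] greedyD(2)[OF u' ufU[of i]] \<beta> by simp
  qed
  \<comment> \<open>The cut built at \<open>xt (t i) k\<close> enters at iteration
    \<open>Suc (t i)\<close>; the shifted iterates have the same limit along the same
    points.\<close>
  moreover have "(\<lambda>i. vh (Suc (t i)) k (xt (t i) k)) \<longlonglongrightarrow> vstar k x"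
    using k x xX by (intro vh_tendsto_diagonal filterlim_compose[OF filterlim_Suc tt]) (auto intro: xt_in_X)
  ultimately have "h * ell x u + vstar (Suc k) (F x u) \<le> vstar k x"
    by (intro LIMSEQ_le[OF opt_lim]) auto
  moreover have "vstar k x \<le> h * ell x u + vstar (Suc k) (F x u)"
    using vstar_subsolution[OF k xX] bellman_greedy[OF g] by simp
  ultimately show "vstar k x = h * ell x u + vstar (Suc k) y" using yF by simp
qed

text \<open>Compactness of \<open>U\<close> yields one subsequence along which the controls at all
  times \<open>k < K\<close> converge; \<open>limit_trajectory\<close> then applies at each
  time.\<close>

lemma limit_controls:
  fixes r :: "nat \<Rightarrow> nat"
  assumes r: "strict_mono r" and x: "\<And>k. k \<le> K \<Longrightarrow> (\<lambda>j. xt (r j) k) \<longlonglongrightarrow> xstar k"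
  shows "\<exists>(s :: nat \<Rightarrow> nat) ustar. strict_mono s \<and> (\<forall>k<K. (\<lambda>i. uf (r (s i)) k) \<longlonglongrightarrow> ustar k
    \<and> ustar k \<in> U \<and> xstar (Suc k) = F (xstar k) (ustar k)
    \<and> greedy h ell F U (vstar (Suc k)) (xstar k) (ustar k)
    \<and> vstar k (xstar k) = h * ell (xstar k) (ustar k) + vstar (Suc k) (xstar (Suc k)))"
proof -
  \<comment> \<open>A strictly increasing \<open>r\<close> satisfies \<open>j \<le> r j\<close>, so
    \<open>r (Suc i)\<close> is never iteration 0.\<close>
  have r1: "r (Suc i) \<ge> 1" for i
    using seq_suble[OF r, of "Suc i"] by simp
  \<comment> \<open>The shift avoids the unconstrained controls of iteration 0.\<close>
  obtain s l where s: "strict_mono (s :: nat \<Rightarrow> nat)"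
    and l: "\<And>k. k < K \<Longrightarrow> l k \<in> U \<and> (\<lambda>i. uf (r (Suc (s i))) k) \<longlonglongrightarrow> l k"
    using compact_common_subsequence[OF U(2), of K "\<lambda>i. uf (r (Suc i))"]
      greedyD(1)[OF forward_greedy(1)[OF r1]] by metis
  have s': "strict_mono (\<lambda>i. Suc (s i))" using s by (simp add: strict_mono_def)
  have rs: "strict_mono (\<lambda>i. r (Suc (s i)))" using r s' by (simp add: strict_mono_def)
  have x': "(\<lambda>i. xt (r (Suc (s i))) k) \<longlonglongrightarrow> xstar k" if "k \<le> K" for k
    using LIMSEQ_subseq_LIMSEQ[OF x[OF that] s'] by (simp add: o_def)
  \<comment> \<open>The witnesses are the shifted subsequence \<open>\<lambda>i. Suc (s i)\<close>
    and the limits \<open>l\<close>.\<close>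
  show ?thesis
  proof (intro exI conjI allI impI)
    fix k assume k: "k < K"
    then have x: "(\<lambda>i. xt (r (Suc (s i))) k) \<longlonglongrightarrow> xstar k"
      "(\<lambda>i. xt (r (Suc (s i))) (Suc k)) \<longlonglongrightarrow> xstar (Suc k)"
      using x' by auto
    show u: "(\<lambda>i. uf (r (Suc (s i))) k) \<longlonglongrightarrow> l k" using l[OF k] by simp
    note lims = limit_trajectory[OF k rs r1 x u]
    show "l k \<in> U" "xstar (Suc k) = F (xstar k) (l k)"
      "greedy h ell F U (vstar (Suc k)) (xstar k) (l k)"
      "vstar k (xstar k) = h * ell (xstar k) (l k) + vstar (Suc k) (xstar (Suc k))"
      by (fact lims)+
  qed (rule s')
qed

end

section \<open>The convergence theorem in Euclidean space\<close>

theorem mainTheorem4: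
  fixes h \<gamma> :: real and K :: nat
    and U :: "(real ^ 'q) set" and X :: "(real ^ 'n) set"
    and A :: "real ^ 'n ^ 'n" and B :: "real ^ 'q ^ 'n" and b :: "real ^ 'n"
    and F :: "real ^ 'n \<Rightarrow> real ^ 'q \<Rightarrow> real ^ 'n"
    and ell :: "real ^ 'n \<Rightarrow> real ^ 'q \<Rightarrow> real"
    and \<phi> :: "real ^ 'n \<Rightarrow> real"
    and c :: "nat \<Rightarrow> real"
    and v :: "nat \<Rightarrow> real ^ 'n \<Rightarrow> real"
    and W :: "nat \<Rightarrow> nat \<Rightarrow> (real ^ 'n \<Rightarrow> real) set"
    and vhat :: "nat \<Rightarrow> nat \<Rightarrow> real ^ 'n \<Rightarrow> real"
    and x0 :: "real ^ 'n"
    and xt :: "nat \<Rightarrow> nat \<Rightarrow> real ^ 'n"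
    and uf :: "nat \<Rightarrow> nat \<Rightarrow> real ^ 'q"
  assumes "h > 0" and "K \<ge> 1"
    and "U \<noteq> {}" and "compact U"
    and "\<And>x u. u \<in> U \<Longrightarrow> F x u = A *v x + B *v u + b"
    and "continuous_on UNIV \<phi>" and "c K \<ge> 0" and "semiconvex (c K) \<phi>"
    and "\<gamma> \<ge> 0"
    and "\<And>u. u \<in> U \<Longrightarrow> continuous_on UNIV (\<lambda>x. h * ell x u) \<and> semiconvex \<gamma> (\<lambda>x. h * ell x u)"
    and "\<And>k. k < K \<Longrightarrow> c k = \<gamma> + (onorm (\<lambda>x. A *v x))\<^sup>2 * c (Suc k)"
    and "compact X" and "convex X"
    and "\<And>x u. x \<in> X \<Longrightarrow> u \<in> U \<Longrightarrow> F x u \<in> X"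
    and "continuous_on (UNIV \<times> U) (\<lambda>(x, u). F x u)"
    and "continuous_on (UNIV \<times> U) (\<lambda>(x, u). ell x u)"
    and "\<exists>L. \<forall>u\<in>U. L-lipschitz_on X (\<lambda>x. F x u)"
    and "\<exists>L. \<forall>u\<in>U. L-lipschitz_on X (\<lambda>x. ell x u)"
    and "v K = \<phi>"
    and "\<And>k. k < K \<Longrightarrow> v k = bellman h ell F U (v (Suc k))"
    and "trajectory_algorithm h ell F U K c \<phi> v x0 W xt uf"
    and "\<And>m k. k \<le> K \<Longrightarrow> vhat m k = fmax (W m k)"
    and "\<And>k. k \<le> K \<Longrightarrow> xt 0 k \<in> X"
    and "\<And>k. k \<le> K \<Longrightarrow> \<exists>L. L-lipschitz_on X (vhat 0 k)"
    and "\<And>k x. k < K \<Longrightarrow> x \<in> X \<Longrightarrow> vhat 0 k x \<le> bellman h ell F U (vhat 0 (Suc k)) x"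
  shows "\<exists>vstar :: nat \<Rightarrow> real ^ 'n \<Rightarrow> real.
      (\<forall>k\<le>K. uniform_limit X (\<lambda>m. vhat m k) (vstar k) sequentially
           \<and> (\<exists>L. L-lipschitz_on X (vstar k))
           \<and> (\<forall>m. \<forall>x\<in>X. vhat m k x \<le> vstar k x \<and> vstar k x \<le> v k x))
    \<and> (\<forall>k<K. \<forall>x\<in>X. vstar k x \<le> bellman h ell F U (vstar (Suc k)) x)
    \<and> (\<forall>(r :: nat \<Rightarrow> nat) (xstar :: nat \<Rightarrow> real ^ 'n).
         strict_mono r \<and> (\<forall>k\<le>K. (\<lambda>j. xt (r j) k) \<longlonglongrightarrow> xstar k) \<longrightarrow>
           (\<forall>k\<le>K. xstar k \<in> X)
         \<and> (\<exists>(s :: nat \<Rightarrow> nat) (ustar :: nat \<Rightarrow> real ^ 'q). strict_mono s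
             \<and> (\<forall>k<K. (\<lambda>i. uf (r (s i)) k) \<longlonglongrightarrow> ustar k
                  \<and> ustar k \<in> U
                  \<and> xstar (Suc k) = F (xstar k) (ustar k)
                  \<and> greedy h ell F U (vstar (Suc k)) (xstar k) (ustar k)
                  \<and> vstar k (xstar k) =
                      h * ell (xstar k) (ustar k) + vstar (Suc k) (xstar (Suc k)))))"
proof -
  \<comment> \<open>\<open>vhat\<close> is tied to the families only up to time \<open>K\<close>, so
    each rewriting carries \<open>k \<le> K\<close>.\<close>
  have vhat: "vhat m k = fmax (W m k)" if "k \<le> K" for m k
    using assms(22) that .
  interpret trajectory_run h ell F U X K c \<phi> v x0 W xt uf
  proof
    show "\<exists>L. L-lipschitz_on X (fmax (W 0 k))" if "k \<le> K" for k
      using assms(24)[OF that] vhat[OF that] by simp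
    show "fmax (W 0 k) x \<le> bellman h ell F U (fmax (W 0 (Suc k))) x" if "k < K" "x \<in> X" for k x
      using assms(25)[OF that] vhat[of k 0] vhat[of "Suc k" 0] that(1) by simp
  qed (fact assms(3,4,6,12,14-16,19-21,23))+
  show ?thesis
  proof (intro exI[of _ vstar] conjI allI impI ballI)
    fix k assume k: "k \<le> K"
    show "uniform_limit X (\<lambda>m. vhat m k) (vstar k) sequentially"
      using vstar_uniform_limit[OF k] by (simp add: vhat[OF k])
    show "\<exists>L. L-lipschitz_on X (vstar k)" using k by (rule vstar_lipschitz)
    fix m x
    show "vhat m k x \<le> vstar k x" using vh_le_vstar[OF k] by (simp add: vhat[OF k])
    show "vstar k x \<le> v k x" using k by (rule vstar_le_v)
  next
    fix k x assume "k < K" "x \<in> X"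
    then show "vstar k x \<le> bellman h ell F U (vstar (Suc k)) x" by (rule vstar_subsolution)
  next
    fix r :: "nat \<Rightarrow> nat" and xstar :: "nat \<Rightarrow> real ^ 'n"
    assume r: "strict_mono r \<and> (\<forall>k\<le>K. (\<lambda>j. xt (r j) k) \<longlonglongrightarrow> xstar k)"
    show "xstar k \<in> X" if "k \<le> K" for k
    proof (rule closed_sequentially[OF compact_imp_closed[OF X]])
      show "xt (r j) k \<in> X" for j using that by (rule xt_in_X)
      show "(\<lambda>j. xt (r j) k) \<longlonglongrightarrow> xstar k" using r that by blast
    qed
    show "\<exists>(s :: nat \<Rightarrow> nat) ustar. strict_mono s \<and> (\<forall>k<K. (\<lambda>i. uf (r (s i)) k) \<longlonglongrightarrow> ustar k
        \<and> ustar k \<in> U \<and> xstar (Suc k) = F (xstar k) (ustar k)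
        \<and> greedy h ell F U (vstar (Suc k)) (xstar k) (ustar k)
        \<and> vstar k (xstar k) = h * ell (xstar k) (ustar k) + vstar (Suc k) (xstar (Suc k)))"
    proof (rule limit_controls)
      show "strict_mono r" using r ..
      show "(\<lambda>j. xt (r j) k) \<longlonglongrightarrow> xstar k" if "k \<le> K" for k using r that by blast
    qed
  qed
qed

end
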